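(* A cirquent is provable in $\mathbf{CL5}$ iff it is an instance of a binary tautology.
   Context: Formulas are built from infinitely many propositional atoms using $\neg$ (applied only to atoms; $\neg\neg F$ abbreviates $F$, and $\neg$ of a compound formula is understood via De Morgan's laws), $\wedge$ and $\vee$. A $k$-ary cirquent is a pair consisting of a pool, i.e. a sequence $\langle F_1,\ldots,F_k\rangle$ of formulas (their occurrences are called oformulas), and a structure, i.e. a finite sequence of groups, each group being a subset of $\{1,\ldots,k\}$, thought of as the set of oformulas it contains (occurrences of groups are called ogroups). A formula $F$ is identified with the cirquent with pool $\langle F\rangle$ and structure $\langle\{1\}\rangle$. A classical model assigns a truth value to each atom and extends to formulas in the standard way. A group of a cirquent is true in a model iff at least one of its oformulas is true; a cirquent is true in a model iff all of its groups are true; a cirquent is a tautology iff it is true in every model. A cirquent is binary iff no atom has more than two occurrences in it; a binary tautology is a binary cirquent that is a tautology. A substitution $\sigma$ sends each atom to a formula, extended by $\sigma(\neg P)=\neg\sigma(P)$, $\sigma(F\wedge G)=\sigma(F)\wedge\sigma(G)$, $\sigma(F\vee G)=\sigma(F)\vee\sigma(G)$, and to cirquents by applying it to every oformula; $B$ is an instance of $A$ iff $B=\sigma(A)$ for some substitution $\sigma$. $\mathbf{CL5}$ is the cirquent calculus system with the following seven rules, and a proof of a cirquent is a tree of cirquents with that cirquent at the root, each node following from its children by a rule (leaves being axioms). (Axioms) the empty cirquent (empty pool and empty structure), and the identity axiom: pool $\langle\neg F,F\rangle$, structure $\langle\{1,2\}\rangle$. (Mix) from two premises, the conclusion places one next to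 the other (concatenating pools and structures). (Exchange) swap two adjacent oformulas, correspondingly redirecting group membership, or swap two adjacent ogroups. (Weakening) add an existing oformula to an existing ogroup, or insert a new oformula anywhere in the pool (belonging to no group). (Duplication) downward: replace an ogroup by two adjacent ogroups identical to it as groups; upward: the converse. ($\vee$-introduction) merge two adjacent oformulas $F,G$ into one oformula $F\vee G$, so that an ogroup of the conclusion contains $F\vee G$ iff the corresponding ogroup of the premise contains at least one of $F,G$. ($\wedge$-introduction) the premise has adjacent oformulas $F,G$ such that no ogroup contains both, every ogroup containing $F$ is immediately followed by an ogroup containing $G$, and every ogroup containing $G$ is immediately preceded by an ogroup containing $F$; the conclusion merges each ogroup containing $F$ with the immediately following ogroup (taking the union), and then merges $F$ and $G$ into the single oformula $F\wedge G$. (The contraction rule, which merges two adjacent identical oformulas, is not included in $\mathbf{CL5}$.) *)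

theory Defs
  imports Main "HOL-Combinatorics.Transposition"
begin

datatype 'a formula =
    Atom 'a
  | NegAtom 'a
  | And "'a formula" "'a formula"
  | Or "'a formula" "'a formula"

primrec neg :: "'a formula \<Rightarrow> 'a formula" where
  "neg (Atom P) = NegAtom P"
| "neg (NegAtom P) = Atom P"
| "neg (And F G) = Or (neg F) (neg G)"
| "neg (Or F G) = And (neg F) (neg G)"

primrec formula_true :: "('a \<Rightarrow> bool) \<Rightarrow> 'a formula \<Rightarrow> bool" where
  "formula_true M (Atom P) \<longleftrightarrow> M P"
| "formula_true M (NegAtom P) \<longleftrightarrow> \<not> M P"
| "formula_true M (And F G) \<longleftrightarrow> formula_true M F \<and> formula_true M G"
| "formula_true M (Or F G) \<longleftrightarrow> formula_true M F \<or> formula_true M G"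

primrec formula_occs :: "'a \<Rightarrow> 'a formula \<Rightarrow> nat" where
  "formula_occs P (Atom Q) = (if P = Q then 1 else 0)"
| "formula_occs P (NegAtom Q) = (if P = Q then 1 else 0)"
| "formula_occs P (And F G) = formula_occs P F + formula_occs P G"
| "formula_occs P (Or F G) = formula_occs P F + formula_occs P G"

primrec formula_subst :: "('a \<Rightarrow> 'a formula) \<Rightarrow> 'a formula \<Rightarrow> 'a formula" where
  "formula_subst \<sigma> (Atom P) = \<sigma> P"
| "formula_subst \<sigma> (NegAtom P) = neg (\<sigma> P)"
| "formula_subst \<sigma> (And F G) = And (formula_subst \<sigma> F) (formula_subst \<sigma> G)"
| "formula_subst \<sigma> (Or F G) = Or (formula_subst \<sigma> F) (formula_subst \<sigma> G)"

text \<open>A cirquent is a pair (pool, structure). Oformulas are identified with their positions in the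
  pool, counted from 0, so the groups of a \<open>k\<close>-ary cirquent are subsets of \<open>{..<k}\<close>; this bound is
  imposed by \<open>is_cirquent\<close>. Groups may be empty.\<close>

type_synonym 'a cirquent = "'a formula list \<times> nat set list"

definition is_cirquent :: "'a cirquent \<Rightarrow> bool" where
  "is_cirquent C \<longleftrightarrow> (\<forall>g \<in> set (snd C). g \<subseteq> {..<length (fst C)})"

definition group_true :: "('a \<Rightarrow> bool) \<Rightarrow> 'a formula list \<Rightarrow> nat set \<Rightarrow> bool" where
  "group_true M p g \<longleftrightarrow> (\<exists>i \<in> g. formula_true M (p ! i))"

definition cirquent_true :: "('a \<Rightarrow> bool) \<Rightarrow> 'a cirquent \<Rightarrow> bool" where
  "cirquent_true M C \<longleftrightarrow> (\<forall>g \<in> set (snd C). group_true M (fst C) g)"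

definition tautology :: "'a cirquent \<Rightarrow> bool" where
  "tautology C \<longleftrightarrow> (\<forall>M. cirquent_true M C)"

text \<open>Occurrences are counted in the pool: an oformula contributes once, no matter how many ogroups
  contain it.\<close>

definition cirquent_occs :: "'a \<Rightarrow> 'a cirquent \<Rightarrow> nat" where
  "cirquent_occs P C = (\<Sum>F \<leftarrow> fst C. formula_occs P F)"

definition binary :: "'a cirquent \<Rightarrow> bool" where
  "binary C \<longleftrightarrow> (\<forall>P. cirquent_occs P C \<le> 2)"

definition binary_tautology :: "'a cirquent \<Rightarrow> bool" where
  "binary_tautology C \<longleftrightarrow> is_cirquent C \<and> binary C \<and> tautology C"

definition cirquent_subst :: "('a \<Rightarrow> 'a formula) \<Rightarrow> 'a cirquent \<Rightarrow> 'a cirquent" where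
  "cirquent_subst \<sigma> C = (map (formula_subst \<sigma>) (fst C), snd C)"

definition instance_of :: "'a cirquent \<Rightarrow> 'a cirquent \<Rightarrow> bool" where
  "instance_of B A \<longleftrightarrow> (\<exists>\<sigma>. B = cirquent_subst \<sigma> A)"

text \<open>Renumberings of pool positions: \<open>open_gap n\<close> makes room for a new oformula at position \<open>n\<close>;
  \<open>collapse n\<close> identifies the positions \<open>n\<close> and \<open>Suc n\<close>.\<close>

definition open_gap :: "nat \<Rightarrow> nat \<Rightarrow> nat" where
  "open_gap n i = (if i < n then i else Suc i)"

definition collapse :: "nat \<Rightarrow> nat \<Rightarrow> nat" where
  "collapse n i = (if i \<le> n then i else i - 1)"

text \<open>The side condition of \<open>\<and>\<close>-introduction on the oformulas at positions \<open>n\<close> and \<open>Suc n\<close>.\<close>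

definition and_ready :: "nat \<Rightarrow> nat set list \<Rightarrow> bool" where
  "and_ready n s \<longleftrightarrow> (\<forall>j < length s.
     \<not> (n \<in> s ! j \<and> Suc n \<in> s ! j) \<and>
     (n \<in> s ! j \<longrightarrow> Suc j < length s \<and> Suc n \<in> s ! Suc j) \<and>
     (Suc n \<in> s ! j \<longrightarrow> 0 < j \<and> n \<in> s ! (j - 1)))"

text \<open>Merges every ogroup containing \<open>n\<close> with its successor. If \<open>and_ready n s\<close> holds, the successor
  never contains \<open>n\<close> itself, so skipping over it is harmless.\<close>

fun merge_groups :: "nat \<Rightarrow> nat set list \<Rightarrow> nat set list" where
  "merge_groups n [] = []"
| "merge_groups n [g] = [g]"
| "merge_groups n (g # h # s) =
     (if n \<in> g then (g \<union> h) # merge_groups n s else g # merge_groups n (h # s))"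

inductive CL5 :: "'a cirquent \<Rightarrow> bool" where
  empty_axiom: "CL5 ([], [])"
| identity_axiom: "CL5 ([neg F, F], [{0, 1}])"
| mix: "CL5 (p, s) \<Longrightarrow> CL5 (q, t) \<Longrightarrow> CL5 (p @ q, s @ map (image (\<lambda>i. length p + i)) t)"
| oformula_exchange: "CL5 (p @ [F, G] @ q, s) \<Longrightarrow>
    CL5 (p @ [G, F] @ q, map (image (transpose (length p) (Suc (length p)))) s)"
| ogroup_exchange: "CL5 (p, s @ [g, h] @ t) \<Longrightarrow> CL5 (p, s @ [h, g] @ t)"
| ogroup_weakening: "CL5 (p, s @ [g] @ t) \<Longrightarrow> i < length p \<Longrightarrow> CL5 (p, s @ [insert i g] @ t)"
| pool_weakening: "CL5 (p @ q, s) \<Longrightarrow>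
    CL5 (p @ [F] @ q, map (image (open_gap (length p))) s)"
| duplication_down: "CL5 (p, s @ [g] @ t) \<Longrightarrow> CL5 (p, s @ [g, g] @ t)"
| duplication_up: "CL5 (p, s @ [g, g] @ t) \<Longrightarrow> CL5 (p, s @ [g] @ t)"
| or_introduction: "CL5 (p @ [F, G] @ q, s) \<Longrightarrow>
    CL5 (p @ [Or F G] @ q, map (image (collapse (length p))) s)"
| and_introduction: "CL5 (p @ [F, G] @ q, s) \<Longrightarrow> and_ready (length p) s \<Longrightarrow>
    CL5 (p @ [And F G] @ q, map (image (collapse (length p))) (merge_groups (length p) s))"

end

theory Submission
  imports Defs "HOL-Library.Multiset"
begin

text \<open>
  Soundness: every rule preserves tautologies, and running a proof with a fresh atom \<open>P\<close> in place
  of \<open>F\<close> in each identity axiom, and a fresh atom for each weakened-in oformula, turns it into a proof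
  of a binary cirquent, of which the original conclusion is an instance; contraction is the only rule
  that would break this.

  Completeness: provability is closed under substitution, so it suffices to prove binary tautologies.
  The rules for \<open>\<or>\<close> and \<open>\<and>\<close> can be inverted, splitting each group that contains a conjunction in two,
  which leaves a pool of literals. There every group contains a complementary pair, and since the
  cirquent is binary, distinct such pairs are disjoint; so they come from identity axioms by mix, and
  the rest is duplication, weakening and exchange.
\<close>

section \<open>Formulas, and the renumbering of pool positions\<close>

lemma formula_occs_eq_0_iff: "formula_occs P F = 0 \<longleftrightarrow> P \<notin> set_formula F"
  by (induction F) auto

lemma formula_subst_cong:
  "(\<And>P. P \<in> set_formula F \<Longrightarrow> \<sigma> P = \<tau> P) \<Longrightarrow> formula_subst \<sigma> F = formula_subst \<tau> F"
  by (induction F) auto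

lemma neg_neg [simp]: "neg (neg F) = F"
  by (induction F) auto

lemma formula_subst_neg: "formula_subst \<sigma> (neg F) = neg (formula_subst \<sigma> F)"
  by (induction F) auto

lemma formula_true_neg [simp]: "formula_true M (neg F) \<longleftrightarrow> \<not> formula_true M F"
  by (induction F) auto

lemma group_true_image: "group_true M p (f ` g) \<longleftrightarrow> (\<exists>i\<in>g. formula_true M (p ! f i))"
  by (auto simp: group_true_def)

lemma nth_transpose:
  "(p @ [G, F] @ q) ! transpose (length p) (Suc (length p)) i = (p @ [F, G] @ q) ! i"
  by (auto simp: transpose_def nth_append nth_Cons split: nat.splits)

lemma nth_open_gap: "(p @ [F] @ q) ! open_gap (length p) i = (p @ q) ! i"
  by (auto simp: open_gap_def nth_append Suc_diff_le)

text \<open>Past the merged pair two shifts cancel: the pool with \<open>F\<close> and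
  \<open>G\<close> is one entry longer, and \<open>collapse\<close> lowers the index by one. The
  entries \<open>F\<close> and \<open>G\<close> themselves are masked by the conditional.\<close>

lemma nth_collapse:
  "(p @ [H] @ q) ! collapse (length p) i =
     (if i = length p \<or> i = Suc (length p) then H else (p @ [F, G] @ q) ! i)"
proof (cases "Suc (length p) < i")
  case True
  then obtain k where "i = length p + Suc (Suc k)"
    by (metis add_Suc_right less_iff_Suc_add add_Suc)
  then show ?thesis by (simp add: collapse_def nth_append)
qed (auto simp: collapse_def nth_append less_Suc_eq)

text \<open>Surjectivity makes the image of a preimage the original group, so that introducing a
  connective after inverting it restores the structure exactly.\<close>

lemma surj_collapse [simp]: "surj (collapse n)"
proof (rule surjI)
  show "collapse n (if i \<le> n then i else Suc i) = i" for i
    by (simp add: collapse_def)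
qed

lemma collapse_less: "i < Suc (Suc (n + m)) \<Longrightarrow> collapse n i < Suc (n + m)"
  by (auto simp: collapse_def)

lemma collapse_self [simp]: "collapse n n = n" "collapse n (Suc n) = n"
  by (simp_all add: collapse_def)

section \<open>Merging of groups under the side condition of \<and>-introduction\<close>

lemma merge_groups_Cons: "n \<notin> g \<Longrightarrow> merge_groups n (g # s) = g # merge_groups n s"
  by (cases s) auto

lemma merge_groups_subset: "g \<in> set (merge_groups n s) \<Longrightarrow> g \<subseteq> \<Union> (set s)"
  by (induction n s arbitrary: g rule: merge_groups.induct) (fastforce split: if_splits)+

lemma and_ready_Nil: "and_ready n []"
  by (simp add: and_ready_def)

text \<open>Indices shift by one. The delicate group is the first of \<open>s\<close>, whose
  predecessor is \<open>g\<close>: as \<open>n\<close> is not in \<open>g\<close>, that group cannot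
  contain \<open>Suc n\<close> in either reading.\<close>

lemma and_ready_Cons:
  assumes "n \<notin> g" "Suc n \<notin> g"
  shows "and_ready n (g # s) \<longleftrightarrow> and_ready n s"
proof
  assume A: "and_ready n (g # s)"
  show "and_ready n s"
    unfolding and_ready_def
  proof (intro allI impI)
    fix j assume "j < length s"
    with A[unfolded and_ready_def, rule_format, of "Suc j"] assms
    show "\<not> (n \<in> s ! j \<and> Suc n \<in> s ! j) \<and>
      (n \<in> s ! j \<longrightarrow> Suc j < length s \<and> Suc n \<in> s ! Suc j) \<and>
      (Suc n \<in> s ! j \<longrightarrow> 0 < j \<and> n \<in> s ! (j - 1))"
      by (cases j) auto
  qed
next
  assume A: "and_ready n s"
  show "and_ready n (g # s)"
    unfolding and_ready_def
  proof (intro allI impI)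
    fix j assume j: "j < length (g # s)"
    show "\<not> (n \<in> (g # s) ! j \<and> Suc n \<in> (g # s) ! j) \<and>
      (n \<in> (g # s) ! j \<longrightarrow> Suc j < length (g # s) \<and> Suc n \<in> (g # s) ! Suc j) \<and>
      (Suc n \<in> (g # s) ! j \<longrightarrow> 0 < j \<and> n \<in> (g # s) ! (j - 1))"
    proof (cases j)
      case (Suc k)
      with A[unfolded and_ready_def, rule_format, of k] j show ?thesis
        by (cases k) auto
    qed (use assms in auto)
  qed
qed

lemma and_ready_Cons_Cons:
  assumes "n \<in> g" "Suc n \<notin> g" "n \<notin> h" "Suc n \<in> h"
  shows "and_ready n (g # h # s) \<longleftrightarrow> and_ready n s"
proof
  assume A: "and_ready n (g # h # s)"
  show "and_ready n s"
    unfolding and_ready_def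
  proof (intro allI impI)
    fix j assume "j < length s"
    with A[unfolded and_ready_def, rule_format, of "Suc (Suc j)"] assms
    show "\<not> (n \<in> s ! j \<and> Suc n \<in> s ! j) \<and>
      (n \<in> s ! j \<longrightarrow> Suc j < length s \<and> Suc n \<in> s ! Suc j) \<and>
      (Suc n \<in> s ! j \<longrightarrow> 0 < j \<and> n \<in> s ! (j - 1))"
      by (cases j) auto
  qed
next
  assume A: "and_ready n s"
  show "and_ready n (g # h # s)"
    unfolding and_ready_def
  proof (intro allI impI)
    fix j assume j: "j < length (g # h # s)"
    show "\<not> (n \<in> (g # h # s) ! j \<and> Suc n \<in> (g # h # s) ! j) \<and>
      (n \<in> (g # h # s) ! j \<longrightarrow>
        Suc j < length (g # h # s) \<and> Suc n \<in> (g # h # s) ! Suc j) \<and>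
      (Suc n \<in> (g # h # s) ! j \<longrightarrow> 0 < j \<and> n \<in> (g # h # s) ! (j - 1))"
    proof (cases "j < 2")
      case True
      then have "j = 0 \<or> j = 1" by auto
      then show ?thesis using assms by auto
    next
      case False
      then obtain k where k: "j = Suc (Suc k)"
        by (metis One_nat_def Suc_1 less_Suc_eq_0_disj not0_implies_Suc)
      with A[unfolded and_ready_def, rule_format, of k] j show ?thesis
        by (cases k) auto
    qed
  qed
qed

text \<open>The side condition cuts a structure into single groups avoiding both positions and
  adjacent pairs of groups, the first with \<open>n\<close> only, the second with
  \<open>Suc n\<close> only. \<open>merge_groups\<close> treats exactly these blocks.\<close>

lemma and_ready_induct [consumes 1, case_names Nil Cons Cons_Cons]:
  assumes "and_ready n s"
    and "P []"
    and "\<And>g s. n \<notin> g \<Longrightarrow> Suc n \<notin> g \<Longrightarrow> P s \<Longrightarrow> P (g # s)"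
    and "\<And>g h s. n \<in> g \<Longrightarrow> Suc n \<notin> g \<Longrightarrow> n \<notin> h \<Longrightarrow> Suc n \<in> h \<Longrightarrow> P s \<Longrightarrow> P (g # h # s)"
  shows "P s"
  using assms(1)
proof (induction s rule: length_induct)
  case (1 s)
  show ?case
  proof (cases s)
    case Nil
    then show ?thesis using assms(2) by simp
  next
    case (Cons g t)
    have g: "Suc n \<notin> g"
      using 1(2) Cons by (auto simp: and_ready_def)
    show ?thesis
    proof (cases "n \<in> g")
      case False
      then show ?thesis
        using 1 Cons g and_ready_Cons assms(3) by (metis length_Cons lessI)
    next
      case True
      with 1(2) Cons have "0 < length t" "Suc n \<in> t ! 0"
        by (auto simp: and_ready_def)
      then obtain h u where t: "t = h # u" "Suc n \<in> h"
        by (cases t) auto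
      then have "n \<notin> h"
        using 1(2) Cons by (auto simp: and_ready_def)
      then show ?thesis
        using 1 Cons g True t and_ready_Cons_Cons[of n g h u] assms(4)
        by (metis length_Cons lessI less_Suc_eq)
    qed
  qed
qed

section \<open>Soundness\<close>

lemma CL5_is_cirquent: "CL5 C \<Longrightarrow> is_cirquent C"
proof (induction rule: CL5.induct)
  case (oformula_exchange p F G q s)
  then show ?case by (fastforce simp: is_cirquent_def transpose_def)
next
  case (pool_weakening p q s F)
  then show ?case by (fastforce simp: is_cirquent_def open_gap_def)
next
  case (or_introduction p F G q s)
  then show ?case by (fastforce simp: is_cirquent_def intro: collapse_less)
next
  case (and_introduction p F G q s)
  then have "\<Union> (set s) \<subseteq> {..<Suc (Suc (length p + length q))}"
    by (auto simp: is_cirquent_def)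
  then show ?case
    using merge_groups_subset by (fastforce simp: is_cirquent_def intro: collapse_less)
qed (fastforce simp: is_cirquent_def)+

text \<open>If the witnesses of a merged pair are the two conjuncts, their conjunction is true;
  otherwise some witness lies outside both positions and survives the merge.\<close>

lemma merge_groups_sound:
  assumes "and_ready (length p) s"
    and "\<forall>g\<in>set s. group_true M (p @ [F, G] @ q) g"
  shows "\<forall>g\<in>set (merge_groups (length p) s).
    group_true M (p @ [And F G] @ q) (collapse (length p) ` g)"
  using assms
proof (induction rule: and_ready_induct)
  case Nil
  then show ?case by simp
next
  case (Cons g s)
  then obtain i where i: "i \<in> g" "formula_true M ((p @ [F, G] @ q) ! i)"
    by (auto simp: group_true_def)
  then have "i \<noteq> length p" "i \<noteq> Suc (length p)"
    using Cons by auto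
  then have "group_true M (p @ [And F G] @ q) (collapse (length p) ` g)"
    unfolding group_true_image nth_collapse[where F=F and G=G] using i by auto
  then show ?case using Cons by (simp add: merge_groups_Cons)
next
  case (Cons_Cons g h s)
  then obtain i j where ij: "i \<in> g" "formula_true M ((p @ [F, G] @ q) ! i)"
      "j \<in> h" "formula_true M ((p @ [F, G] @ q) ! j)"
    by (auto simp: group_true_def)
  have "group_true M (p @ [And F G] @ q) (collapse (length p) ` (g \<union> h))"
  proof (cases "i = length p \<and> j = Suc (length p)")
    case True
    then have "formula_true M (And F G)"
      using ij by (simp add: nth_append)
    then show ?thesis
      unfolding group_true_image nth_collapse[where F=F and G=G] using ij True by auto
  next
    case False
    moreover have "i \<noteq> Suc (length p)" "j \<noteq> length p"
      using Cons_Cons ij by auto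
    ultimately show ?thesis
      unfolding group_true_image nth_collapse[where F=F and G=G] using ij by auto
  qed
  then show ?case using Cons_Cons by simp
qed

text \<open>The model is fixed before the induction, since each rule preserves truth in every single
  model.\<close>

lemma CL5_sound: "CL5 C \<Longrightarrow> tautology C"
proof -
  have "CL5 C \<Longrightarrow> cirquent_true M C" for M
  proof (induction rule: CL5.induct)
    case (mix p s q t)
    \<comment> \<open>Without this bound, appending \<open>q\<close> could change the oformulas that
      the groups of \<open>s\<close> refer to.\<close>
    then have "\<forall>g\<in>set s. g \<subseteq> {..<length p}"
      using CL5_is_cirquent by (force simp: is_cirquent_def)
    then have "\<forall>g\<in>set s. group_true M (p @ q) g"
      using mix by (fastforce simp: cirquent_true_def group_true_def nth_append)
    then show ?case
      using mix by (auto simp: cirquent_true_def group_true_image) (auto simp: group_true_def)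
  next
    case (oformula_exchange p F G q s)
    then show ?case
      by (auto simp: cirquent_true_def group_true_image nth_transpose simp del: append.simps)
        (auto simp: group_true_def)
  next
    case (pool_weakening p q s F)
    then show ?case
      by (auto simp: cirquent_true_def group_true_image nth_open_gap simp del: append.simps)
        (auto simp: group_true_def)
  next
    case (or_introduction p F G q s)
    have "formula_true M ((p @ [Or F G] @ q) ! collapse (length p) i)"
      if "formula_true M ((p @ [F, G] @ q) ! i)" for i
      unfolding nth_collapse[where F=F and G=G] using that by (auto simp: nth_append)
    then show ?case
      using or_introduction unfolding cirquent_true_def
      by (auto simp: group_true_image simp del: append.simps) (metis group_true_def)
  next
    case (and_introduction p F G q s)
    then show ?case
      using merge_groups_sound[of p s M F G q] by (simp add: cirquent_true_def)
  qed (auto simp: cirquent_true_def group_true_def)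
  then show "CL5 C \<Longrightarrow> tautology C"
    by (simp add: tautology_def)
qed

section \<open>Closure under substitution, and lifting of proofs to binary cirquents\<close>

text \<open>Every rule is schematic in its oformulas and refers only to positions; the identity
  axiom survives because substitution commutes with \<open>neg\<close>.\<close>

lemma CL5_subst: "CL5 C \<Longrightarrow> CL5 (cirquent_subst \<sigma> C)"
proof (induction rule: CL5.induct)
  case (identity_axiom F)
  show ?case
    by (simp add: cirquent_subst_def formula_subst_neg CL5.identity_axiom[simplified])
next
  case (mix p s q t)
  then show ?case
    using CL5.mix[of "map (formula_subst \<sigma>) p"] by (simp add: cirquent_subst_def)
next
  case (oformula_exchange p F G q s)
  then show ?case
    using CL5.oformula_exchange[of "map (formula_subst \<sigma>) p"] by (simp add: cirquent_subst_def)
next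
  case (pool_weakening p q s F)
  then show ?case
    using CL5.pool_weakening[of "map (formula_subst \<sigma>) p"] by (simp add: cirquent_subst_def)
next
  case (or_introduction p F G q s)
  then show ?case
    using CL5.or_introduction[of "map (formula_subst \<sigma>) p"] by (simp add: cirquent_subst_def)
next
  case (and_introduction p F G q s)
  then show ?case
    using CL5.and_introduction[of "map (formula_subst \<sigma>) p"] by (simp add: cirquent_subst_def)
qed (auto simp: cirquent_subst_def intro: CL5.intros[simplified])

definition cirquent_atoms :: "'a cirquent \<Rightarrow> 'a set" where
  "cirquent_atoms C = \<Union> (set_formula ` set (fst C))"

lemma finite_cirquent_atoms: "finite (cirquent_atoms C)"
proof -
  have "finite (set_formula F)" for F :: "'a formula"
    by (induction F) auto
  then show ?thesis by (auto simp: cirquent_atoms_def)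
qed

lemma cirquent_occs_eq_0: "P \<notin> cirquent_atoms C \<Longrightarrow> cirquent_occs P C = 0"
  by (auto simp: cirquent_atoms_def cirquent_occs_def formula_occs_eq_0_iff)

text \<open>Avoiding an arbitrary finite set of atoms is what makes the two premises of mix
  combinable.\<close>

lemma CL5_instance_of_binary:
  fixes C :: "'a cirquent" and X :: "'a set"
  assumes inf: "infinite (UNIV :: 'a set)"
    and "CL5 C" "finite X"
  shows "\<exists>p \<sigma>. CL5 (p, snd C) \<and> binary (p, snd C) \<and> cirquent_atoms (p, snd C) \<inter> X = {} \<and>
    fst C = map (formula_subst \<sigma>) p"
  using assms(2,3)
proof (induction arbitrary: X rule: CL5.induct)
  case empty_axiom
  show ?case
    by (intro exI[of _ "[]"]) (auto simp: binary_def cirquent_occs_def cirquent_atoms_def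
      intro: CL5.intros)
next
  case (identity_axiom F)
  then obtain P where "P \<notin> X"
    using inf ex_new_if_finite by blast
  then show ?case
    using CL5.identity_axiom[of "Atom P"]
    \<comment> \<open>The pool has no atom but \<open>P\<close>, so a constant substitution
      suffices.\<close>
    by (intro exI[of _ "[neg (Atom P), Atom P]"] exI[of _ "\<lambda>_. F"])
      (auto simp: binary_def cirquent_occs_def cirquent_atoms_def)
next
  case (mix p s q t)
  from mix.IH(1)[OF \<open>finite X\<close>] obtain p' \<sigma> where p':
    "CL5 (p', s)" "binary (p', s)" "cirquent_atoms (p', s) \<inter> X = {}" "p = map (formula_subst \<sigma>) p'"
    by auto
  have "finite (X \<union> cirquent_atoms (p', s))"
    using \<open>finite X\<close> finite_cirquent_atoms by blast
  from mix.IH(2)[OF this] obtain q' \<tau> where q':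
    "CL5 (q', t)" "binary (q', t)" "cirquent_atoms (q', t) \<inter> (X \<union> cirquent_atoms (p', s)) = {}"
    "q = map (formula_subst \<tau>) q'"
    by auto
  \<comment> \<open>The two substitutions are glued along disjoint sets of atoms, so
    \<open>\<rho>\<close> agrees with each on its own pool.\<close>
  define \<rho> where "\<rho> P = (if P \<in> cirquent_atoms (p', s) then \<sigma> P else \<tau> P)" for P
  have "map (formula_subst \<rho>) p' = p"
    unfolding p'(4) by (auto simp: \<rho>_def cirquent_atoms_def intro!: formula_subst_cong)
  moreover have "map (formula_subst \<rho>) q' = q"
    unfolding q'(4)
  proof (intro map_cong refl formula_subst_cong)
    fix F P assume "F \<in> set q'" "P \<in> set_formula F"
    then have "P \<in> cirquent_atoms (q', t)"
      by (auto simp: cirquent_atoms_def)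
    then show "\<rho> P = \<tau> P"
      using q'(3) by (auto simp: \<rho>_def)
  qed
  \<comment> \<open>By disjointness one of the two summands is always 0, so the bound 2 is
    kept.\<close>
  moreover have "cirquent_occs P (p' @ q', u) = cirquent_occs P (p', s) + cirquent_occs P (q', t)"
    for P u
    by (simp add: cirquent_occs_def)
  then have "binary (p' @ q', u)" for u
    unfolding binary_def using p'(2) q'(2,3) cirquent_occs_eq_0[of _ "(p', s)"]
      cirquent_occs_eq_0[of _ "(q', t)"]
    by (metis (no_types, lifting) IntI UnCI add.right_neutral add_0 binary_def emptyE)
  moreover have "CL5 (p' @ q', s @ map ((`) (\<lambda>i. length p + i)) t)"
    using CL5.mix[OF p'(1) q'(1)] p'(4) by simp
  moreover have "cirquent_atoms (p' @ q', u) \<inter> X = {}" for u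
    using p'(3) q'(3) by (auto simp: cirquent_atoms_def)
  ultimately show ?case
    by (intro exI[of _ "p' @ q'"] exI[of _ \<rho>]) auto
next
  case (oformula_exchange p F G q s)
  from oformula_exchange.IH[OF \<open>finite X\<close>] obtain p' \<sigma> where p':
    "CL5 (p', s)" "binary (p', s)" "cirquent_atoms (p', s) \<inter> X = {}"
    "p @ [F, G] @ q = map (formula_subst \<sigma>) p'"
    by auto
  \<comment> \<open>Substitution acts entry by entry, so the decomposition of the instance pulls
    back to the binary pool; the connective cases do the same.\<close>
  then obtain a F' G' b where ab: "p' = a @ [F', G'] @ b" "p = map (formula_subst \<sigma>) a"
    "F = formula_subst \<sigma> F'" "G = formula_subst \<sigma> G'" "q = map (formula_subst \<sigma>) b"
    by (auto simp: append_eq_map_conv Cons_eq_map_conv)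
  then show ?case
    using p' CL5.oformula_exchange[of a F' G' b s]
    by (intro exI[of _ "a @ [G', F'] @ b"] exI[of _ \<sigma>])
      (auto simp: binary_def cirquent_occs_def cirquent_atoms_def add_ac)
next
  case (ogroup_exchange p s g h t)
  from ogroup_exchange.IH[OF \<open>finite X\<close>] show ?case
    by (auto simp: binary_def cirquent_occs_def cirquent_atoms_def
      intro: CL5.ogroup_exchange[simplified])
next
  case (ogroup_weakening p s g t i)
  from ogroup_weakening.IH[OF \<open>finite X\<close>] obtain p' \<sigma> where p':
    "CL5 (p', s @ [g] @ t)" "binary (p', s @ [g] @ t)"
    "cirquent_atoms (p', s @ [g] @ t) \<inter> X = {}" "p = map (formula_subst \<sigma>) p'"
    by auto
  then have "CL5 (p', s @ [insert i g] @ t)"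
    using \<open>i < length p\<close> by (intro CL5.ogroup_weakening) auto
  then show ?case
    using p' by (intro exI[of _ p'] exI[of _ \<sigma>])
      (auto simp: binary_def cirquent_occs_def cirquent_atoms_def)
next
  case (pool_weakening p q s F)
  from pool_weakening.IH[OF \<open>finite X\<close>] obtain p' \<sigma> where p':
    "CL5 (p', s)" "binary (p', s)" "cirquent_atoms (p', s) \<inter> X = {}"
    "p @ q = map (formula_subst \<sigma>) p'"
    by auto
  then obtain a b where ab: "p' = a @ b" "p = map (formula_subst \<sigma>) a" "q = map (formula_subst \<sigma>) b"
    by (auto simp: append_eq_map_conv)
  have "finite (X \<union> cirquent_atoms (p', s))"
    using \<open>finite X\<close> finite_cirquent_atoms by blast
  then obtain P where P: "P \<notin> X" "P \<notin> cirquent_atoms (p', s)"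
    using inf ex_new_if_finite by (metis UnCI)
  have "cirquent_occs Q (a @ [Atom P] @ b, u) = (if Q = P then 1 else cirquent_occs Q (p', s))" for Q u
    using cirquent_occs_eq_0[OF P(2)] ab by (auto simp: cirquent_occs_def)
  then have "binary (a @ [Atom P] @ b, u)" for u
    using p'(2) by (auto simp: binary_def)
  \<comment> \<open>As \<open>P\<close> is fresh, sending it to \<open>F\<close> leaves the old
    instance intact while \<open>Atom P\<close> becomes the new oformula.\<close>
  moreover have "map (formula_subst (\<sigma>(P := F))) (a @ b) = map (formula_subst \<sigma>) (a @ b)"
    using P ab by (intro map_cong refl formula_subst_cong) (auto simp: cirquent_atoms_def)
  ultimately show ?case
    using p' ab P CL5.pool_weakening[of a b s "Atom P"]
    by (intro exI[of _ "a @ [Atom P] @ b"] exI[of _ "\<sigma>(P := F)"])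
      (auto simp: cirquent_atoms_def fun_upd_same simp del: fun_upd_apply)
next
  case (duplication_down p s g t)
  from duplication_down.IH[OF \<open>finite X\<close>] show ?case
    by (auto simp: binary_def cirquent_occs_def cirquent_atoms_def
      intro: CL5.duplication_down[simplified])
next
  case (duplication_up p s g t)
  from duplication_up.IH[OF \<open>finite X\<close>] show ?case
    by (auto simp: binary_def cirquent_occs_def cirquent_atoms_def
      intro: CL5.duplication_up[simplified])
next
  case (or_introduction p F G q s)
  from or_introduction.IH[OF \<open>finite X\<close>] obtain p' \<sigma> where p':
    "CL5 (p', s)" "binary (p', s)" "cirquent_atoms (p', s) \<inter> X = {}"
    "p @ [F, G] @ q = map (formula_subst \<sigma>) p'"
    by auto
  then obtain a F' G' b where ab: "p' = a @ [F', G'] @ b" "p = map (formula_subst \<sigma>) a"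
    "F = formula_subst \<sigma> F'" "G = formula_subst \<sigma> G'" "q = map (formula_subst \<sigma>) b"
    by (auto simp: append_eq_map_conv Cons_eq_map_conv)
  then show ?case
    using p' CL5.or_introduction[of a F' G' b s]
    by (intro exI[of _ "a @ [Or F' G'] @ b"] exI[of _ \<sigma>])
      (auto simp: binary_def cirquent_occs_def cirquent_atoms_def add_ac)
next
  case (and_introduction p F G q s)
  from and_introduction.IH[OF \<open>finite X\<close>] obtain p' \<sigma> where p':
    "CL5 (p', s)" "binary (p', s)" "cirquent_atoms (p', s) \<inter> X = {}"
    "p @ [F, G] @ q = map (formula_subst \<sigma>) p'"
    by auto
  then obtain a F' G' b where ab: "p' = a @ [F', G'] @ b" "p = map (formula_subst \<sigma>) a"
    "F = formula_subst \<sigma> F'" "G = formula_subst \<sigma> G'" "q = map (formula_subst \<sigma>) b"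
    by (auto simp: append_eq_map_conv Cons_eq_map_conv)
  then show ?case
    using p' and_introduction.hyps(2) CL5.and_introduction[of a F' G' b s]
    by (intro exI[of _ "a @ [And F' G'] @ b"] exI[of _ \<sigma>])
      (auto simp: binary_def cirquent_occs_def cirquent_atoms_def add_ac)
qed

section \<open>Structural rules: permuting, repeating and weakening groups\<close>

text \<open>Adjacent swaps generate all permutations. The predicate is abstract so that both
  exchange rules, for ogroups and for oformulas, can use it.\<close>

lemma adjacent_swaps_mset:
  assumes swap: "\<And>us x y vs. P (us @ [x, y] @ vs) \<Longrightarrow> P (us @ [y, x] @ vs)"
    and "mset xs = mset ys" "P xs"
  shows "P ys"
proof -
  \<comment> \<open>The element \<open>x\<close> travels left past \<open>us\<close>, one swap at a
    time, starting with the last entry of \<open>us\<close>.\<close>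
  have shift: "P (zs @ us @ [x] @ vs) \<Longrightarrow> P (zs @ [x] @ us @ vs)" for zs us x vs
  proof (induction us arbitrary: vs rule: rev_induct)
    case (snoc u us)
    then show ?case
      using swap[of "zs @ us" u x vs] by simp
  qed simp
  have "mset xs = mset ys \<Longrightarrow> P (zs @ xs) \<Longrightarrow> P (zs @ ys)" for zs
  proof (induction ys arbitrary: xs zs)
    case (Cons y ys)
    then obtain us vs where xs: "xs = us @ [y] @ vs"
      by (metis append_Cons append_Nil list.set_intros(1) set_mset_mset split_list)
    then have "P ((zs @ [y]) @ us @ vs)"
      using Cons.prems(2) shift[of zs us y vs] by simp
    moreover have "mset (us @ vs) = mset ys"
      using Cons.prems(1) xs by simp
    ultimately show ?case
      using Cons.IH[of "us @ vs" "zs @ [y]"] by simp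
  qed simp
  from this[of "[]"] show ?thesis using assms by simp
qed

lemma CL5_mset_groups:
  assumes "mset s = mset t" "CL5 (p, s)"
  shows "CL5 (p, t)"
  using adjacent_swaps_mset[where P = "\<lambda>s. CL5 (p, s)", OF CL5.ogroup_exchange assms] .

text \<open>Exchange brings the two copies of \<open>g\<close> to the front, where duplication in
  its two directions applies. The prefix \<open>u\<close> serves the induction on
  \<open>remdups\<close>.\<close>

lemma CL5_repeated_group:
  assumes "g \<in> set s"
  shows "CL5 (p, u @ g # s) \<longleftrightarrow> CL5 (p, u @ s)"
proof -
  obtain a b where s: "s = a @ g # b"
    using assms by (meson split_list)
  have "CL5 (p, u @ g # s) \<longleftrightarrow> CL5 (p, [] @ [g, g] @ u @ a @ b)"
    using s by (auto elim!: CL5_mset_groups[rotated])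
  also have "\<dots> \<longleftrightarrow> CL5 (p, [] @ [g] @ u @ a @ b)"
    using CL5.duplication_down CL5.duplication_up by blast
  also have "\<dots> \<longleftrightarrow> CL5 (p, u @ s)"
    using s by (auto elim!: CL5_mset_groups[rotated])
  finally show ?thesis .
qed

lemma CL5_remdups_groups: "CL5 (p, u @ remdups s) \<longleftrightarrow> CL5 (p, u @ s)"
proof (induction s arbitrary: u)
  case (Cons g s)
  show ?case
    using Cons[of "u @ [g]"] Cons[of u] CL5_repeated_group[of g s p u] by auto
qed simp

lemma CL5_set_groups:
  assumes "set s = set t" "CL5 (p, s)"
  shows "CL5 (p, t)"
  using assms CL5_remdups_groups[of p "[]"] CL5_mset_groups set_eq_iff_mset_remdups_eq
  by (metis append_Nil)

lemma CL5_weaken_group: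
  assumes "finite h" "h \<subseteq> {..<length p}" "CL5 (p, s @ g # t)"
  shows "CL5 (p, s @ (h \<union> g) # t)"
  using assms
proof (induction h rule: finite_induct)
  case (insert i h)
  then show ?case
    using CL5.ogroup_weakening[of p s "h \<union> g" t i] by simp
qed simp

text \<open>Each group is weakened up from its subset \<open>f g\<close>; the prefix
  \<open>u\<close> collects the groups already restored.\<close>

lemma CL5_weaken_groups:
  assumes "\<And>g. g \<in> set s \<Longrightarrow> f g \<subseteq> g" "\<And>g. g \<in> set s \<Longrightarrow> g \<subseteq> {..<length p}"
    and "CL5 (p, u @ map f s)"
  shows "CL5 (p, u @ s)"
  using assms
proof (induction s arbitrary: u)
  case (Cons g s)
  have g: "f g \<subseteq> g" "g \<subseteq> {..<length p}"
    using Cons.prems by auto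
  then have "CL5 (p, u @ (g \<union> f g) # map f s)"
    using Cons.prems(3) CL5_weaken_group[of g p u "f g" "map f s"] finite_subset by auto
  then have "CL5 (p, (u @ [g]) @ map f s)"
    using g by (simp add: Un_absorb2)
  from Cons.IH[OF _ _ this] show ?case
    using Cons.prems by auto
qed simp

section \<open>Cirquents with labelled oformulas\<close>

text \<open>Groups as sets of labels rather than of positions: permuting the pool then leaves them
  unchanged.\<close>

definition positions :: "'b list \<Rightarrow> 'b set \<Rightarrow> nat set" where
  "positions xs g = {i. i < length xs \<and> xs ! i \<in> g}"

definition labelled :: "('b \<Rightarrow> 'a formula) \<Rightarrow> 'b list \<Rightarrow> 'b set list \<Rightarrow> 'a cirquent" where
  "labelled \<phi> xs s = (map \<phi> xs, map (positions xs) s)"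

lemma positions_append:
  "positions (xs @ ys) g = positions xs g \<union> (\<lambda>i. length xs + i) ` positions ys g"
proof (intro set_eqI iffI)
  fix i assume i: "i \<in> positions (xs @ ys) g"
  show "i \<in> positions xs g \<union> (\<lambda>i. length xs + i) ` positions ys g"
  proof (cases "i < length xs")
    case False
    then have "i = length xs + (i - length xs)" "i - length xs \<in> positions ys g"
      using i by (auto simp: positions_def nth_append)
    then show ?thesis by blast
  qed (use i in \<open>auto simp: positions_def nth_append\<close>)
qed (auto simp: positions_def nth_append)

lemma positions_disjoint: "g \<inter> set xs = {} \<Longrightarrow> positions xs g = {}"
  by (auto simp: positions_def)

lemma positions_upt: "g \<subseteq> {..<n} \<Longrightarrow> positions [0..<n] g = g"
  by (auto simp: positions_def)

lemma positions_swap: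
  "positions (us @ [y, x] @ vs) g =
     transpose (length us) (Suc (length us)) ` positions (us @ [x, y] @ vs) g"
proof -
  have sub: "transpose (length us) (Suc (length us)) ` positions (us @ [x, y] @ vs) g
      \<subseteq> positions (us @ [y, x] @ vs) g" for x y
    by (auto simp: positions_def transpose_def nth_append nth_Cons split: nat.splits if_splits)
  \<comment> \<open>The reverse inclusion is the first one with \<open>x\<close> and
    \<open>y\<close> exchanged, transposed once more: a transposition is its own inverse.\<close>
  from image_mono[OF this, of "transpose (length us) (Suc (length us))" y x]
  have "positions (us @ [y, x] @ vs) g
      \<subseteq> transpose (length us) (Suc (length us)) ` positions (us @ [x, y] @ vs) g"
    by (simp add: image_image)
  with sub show ?thesis by blast
qed

lemma CL5_labelled_mset:
  assumes "mset xs = mset ys" "CL5 (labelled \<phi> xs s)"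
  shows "CL5 (labelled \<phi> ys s)"
proof (rule adjacent_swaps_mset[where P = "\<lambda>xs. CL5 (labelled \<phi> xs s)", OF _ assms])
  fix us x y vs assume "CL5 (labelled \<phi> (us @ [x, y] @ vs) s)"
  then have "CL5 (map \<phi> us @ [\<phi> x, \<phi> y] @ map \<phi> vs, map (positions (us @ [x, y] @ vs)) s)"
    by (simp add: labelled_def)
  from CL5.oformula_exchange[OF this]
  show "CL5 (labelled \<phi> (us @ [y, x] @ vs) s)"
    by (simp add: labelled_def positions_swap[of us y x, simplified, symmetric] comp_def)
qed

text \<open>Disjoint label sets keep a group of one premise from acquiring positions in the pool of
  the other.\<close>

lemma CL5_labelled_mix:
  assumes "CL5 (labelled \<phi> xs s)" "CL5 (labelled \<phi> ys t)" "set xs \<inter> set ys = {}"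
    and "\<And>g. g \<in> set s \<Longrightarrow> g \<subseteq> set xs" "\<And>g. g \<in> set t \<Longrightarrow> g \<subseteq> set ys"
  shows "CL5 (labelled \<phi> (xs @ ys) (s @ t))"
proof -
  have "positions (xs @ ys) g = positions xs g" if "g \<in> set s" for g
    using assms(3) assms(4)[OF that] positions_disjoint[of g ys]
    by (auto simp: positions_append)
  moreover have "positions (xs @ ys) g = (\<lambda>i. length xs + i) ` positions ys g" if "g \<in> set t" for g
    using assms(3) assms(5)[OF that] positions_disjoint[of g xs]
    by (auto simp: positions_append)
  ultimately show ?thesis
    using CL5.mix[OF assms(1,2)[unfolded labelled_def]]
    by (simp add: labelled_def comp_def cong: map_cong)
qed

text \<open>New oformulas go to the end of the pool, so the opened gap moves no position in
  use.\<close>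

lemma CL5_labelled_weaken:
  assumes "CL5 (labelled \<phi> xs s)" "\<And>g. g \<in> set s \<Longrightarrow> g \<inter> set ys = {}"
  shows "CL5 (labelled \<phi> (xs @ ys) s)"
proof -
  have "CL5 (map \<phi> (xs @ ys), map (positions xs) s)"
  proof (induction ys rule: rev_induct)
    case Nil
    then show ?case using assms(1) by (simp add: labelled_def)
  next
    case (snoc y ys)
    have "open_gap (length (xs @ ys)) ` positions xs g = positions xs g" for g
      by (auto simp: positions_def open_gap_def image_iff)
    then show ?case
      using CL5.pool_weakening[of "map \<phi> (xs @ ys)" "[]" "map (positions xs) s" "\<phi> y"] snoc
      by (simp add: comp_def)
  qed
  moreover have "map (positions (xs @ ys)) s = map (positions xs) s"
    using assms(2) by (simp add: positions_append positions_disjoint)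
  ultimately show ?thesis by (simp only: labelled_def)
qed

lemma CL5_labelled_pairs:
  assumes "distinct (concat (map (\<lambda>(i, j). [i, j]) ps))"
    and "\<And>i j. (i, j) \<in> set ps \<Longrightarrow> \<phi> i = neg (\<phi> j)"
  shows "CL5 (labelled \<phi> (concat (map (\<lambda>(i, j). [i, j]) ps)) (map (\<lambda>(i, j). {i, j}) ps))"
  using assms
proof (induction ps)
  case Nil
  show ?case by (simp add: labelled_def CL5.empty_axiom)
next
  case (Cons x ps)
  obtain i j where x: "x = (i, j)" by fastforce
  have "positions [i, j] {i, j} = {0, 1}"
    by (auto simp: positions_def less_Suc_eq)
  then have "CL5 (labelled \<phi> [i, j] [{i, j}])"
    using Cons.prems(2)[of i j] x CL5.identity_axiom[of "\<phi> j"] by (simp add: labelled_def)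
  from CL5_labelled_mix[OF this Cons.IH] Cons.prems x
  show ?case by auto
qed

section \<open>Binary tautologies whose oformulas are literals\<close>

text \<open>Three distinct positions would give three occurrences of \<open>Q\<close>. Hence an
  oformula at \<open>j\<close> has at most one partner sharing the atom.\<close>

lemma binary_occurrence_unique:
  assumes "binary (p, s)" and "i < length p" "i' < length p" "j < length p" "i \<noteq> j" "i' \<noteq> j"
    and "Q \<in> set_formula (p ! i)" "Q \<in> set_formula (p ! i')" "Q \<in> set_formula (p ! j)"
  shows "i = i'"
proof (rule ccontr)
  assume "i \<noteq> i'"
  have pos: "1 \<le> formula_occs Q (p ! k)" if "k \<in> {i, i', j}" for k
    using assms that formula_occs_eq_0_iff[of Q "p ! k"] by (auto simp: Suc_le_eq)
  have "3 = (\<Sum>k\<in>{i, i', j}. 1 :: nat)"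
    using \<open>i \<noteq> i'\<close> assms by simp
  also have "\<dots> \<le> (\<Sum>k\<in>{i, i', j}. formula_occs Q (p ! k))"
    by (intro sum_mono pos)
  also have "\<dots> \<le> (\<Sum>k\<in>{0..<length p}. formula_occs Q (p ! k))"
    using assms by (intro sum_mono2) auto
  also have "\<dots> = cirquent_occs Q (p, s)"
    by (simp add: cirquent_occs_def sum_list_sum_nth)
  also have "\<dots> \<le> 2"
    using assms(1) by (simp add: binary_def)
  finally show False by simp
qed

lemma mset_append_complement:
  assumes "distinct xs" "set xs \<subseteq> {..<n}"
  shows "mset (xs @ filter (\<lambda>i. i \<notin> set xs) [0..<n]) = mset [0..<n]"
proof -
  have "set (xs @ filter (\<lambda>i. i \<notin> set xs) [0..<n]) = set [0..<n]"
    using assms(2) by auto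
  moreover have "distinct (xs @ filter (\<lambda>i. i \<notin> set xs) [0..<n])"
    using assms(1) by auto
  ultimately show ?thesis
    by (metis distinct_upt set_eq_iff_mset_eq_distinct)
qed

lemma CL5_literals:
  assumes lit: "\<forall>F\<in>set p. (\<exists>P. F = Atom P) \<or> (\<exists>P. F = NegAtom P)"
    and bt: "binary_tautology (p, s)"
  shows "CL5 (p, s)"
proof -
  have wf: "g \<subseteq> {..<length p}" if "g \<in> set s" for g
    using bt that by (auto simp: binary_tautology_def is_cirquent_def)
  have bin: "binary (p, s)"
    using bt by (simp add: binary_tautology_def)
  \<comment> \<open>The negative literal comes first, as in the identity axiom.\<close>
  define clash where "clash g Q i j \<longleftrightarrow> i \<in> g \<and> j \<in> g \<and> p ! i = NegAtom Q \<and> p ! j = Atom Q"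
    for g Q i j
  have "\<exists>x. case x of (Q, i, j) \<Rightarrow> clash g Q i j" if g: "g \<in> set s" for g
  proof -
    \<comment> \<open>Falsifies every literal of \<open>g\<close>, except for positive ones whose negation is in \<open>g\<close>.\<close>
    define M where "M Q \<longleftrightarrow> (\<exists>i\<in>g. p ! i = NegAtom Q)" for Q
    have "group_true M p g"
      using bt g by (auto simp: binary_tautology_def tautology_def cirquent_true_def)
    then obtain j where j: "j \<in> g" "formula_true M (p ! j)"
      by (auto simp: group_true_def)
    then have "p ! j \<in> set p"
      using wf[OF g] by auto
    \<comment> \<open>A negative literal of \<open>g\<close> is false in \<open>M\<close> by
      construction, so the true one is positive, and \<open>M Q\<close> supplies its
      negation.\<close>
    with lit j obtain Q where "p ! j = Atom Q" "M Q"
      by (metis M_def formula_true.simps(1,2))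
    with j show ?thesis
      by (auto simp: M_def clash_def)
  qed
  then obtain c where c: "\<And>g. g \<in> set s \<Longrightarrow> case c g of (Q, i, j) \<Rightarrow> clash g Q i j"
    by metis
  define pr where "pr g = snd (c g)" for g
  have pr: "\<exists>Q. clash g Q i j" if "g \<in> set s" "pr g = (i, j)" for g i j
    using c[OF that(1)] that(2) by (auto simp: pr_def split: prod.splits)
  \<comment> \<open>Several groups may select the same pair, which can enter the pool only
    once.\<close>
  define ps where "ps = remdups (map pr s)"
  have ps: "\<exists>Q. i < length p \<and> j < length p \<and> p ! i = NegAtom Q \<and> p ! j = Atom Q"
    if "(i, j) \<in> set ps" for i j
  proof -
    from that obtain g where g: "g \<in> set s" "pr g = (i, j)"
      by (auto simp: ps_def)
    then show ?thesis
      using pr[OF g] wf[OF g(1)] by (auto simp: clash_def)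
  qed
  \<comment> \<open>A shared position forces a common atom; opposite signs separate negative from
    positive positions, and binarity leaves one position of each sign.\<close>
  have uniq: "i = i' \<and> j = j'" if ij: "(i, j) \<in> set ps" "(i', j') \<in> set ps" "{i, j} \<inter> {i', j'} \<noteq> {}"
    for i j i' j'
  proof -
    obtain Q where Q: "i < length p" "j < length p" "p ! i = NegAtom Q" "p ! j = Atom Q"
      using ps[OF ij(1)] by auto
    obtain Q' where Q': "i' < length p" "j' < length p" "p ! i' = NegAtom Q'" "p ! j' = Atom Q'"
      using ps[OF ij(2)] by auto
    have "Q = Q'"
      using ij(3) Q Q' by auto
    then have "p ! i' = NegAtom Q" "p ! j' = Atom Q"
      using Q' by simp_all
    moreover from this have "i \<noteq> j" "i' \<noteq> j" "j' \<noteq> i"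
      using Q by auto
    ultimately show ?thesis
      using Q Q'(1,2) binary_occurrence_unique[OF bin, of i i' j Q]
        binary_occurrence_unique[OF bin, of j j' i Q]
      by auto
  qed
  have dist: "distinct (concat (map (\<lambda>(i, j). [i, j]) ps))"
  proof -
    \<comment> \<open>Induction runs over sublists, with \<open>ps\<close> fixed, so that
      \<open>uniq\<close> stays available.\<close>
    have "distinct (concat (map (\<lambda>(i, j). [i, j]) qs))" if "set qs \<subseteq> set ps" "distinct qs" for qs
      using that
    proof (induction qs)
      case (Cons x qs)
      obtain i j where x: "x = (i, j)" by fastforce
      then have "i \<noteq> j"
        using Cons.prems ps[of i j] by auto
      moreover have "{i, j} \<inter> set (concat (map (\<lambda>(i, j). [i, j]) qs)) = {}"
      proof (rule ccontr)
        assume "\<not> ?thesis"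
        then obtain i' j' where ij': "(i', j') \<in> set qs" "{i, j} \<inter> {i', j'} \<noteq> {}"
          by auto
        then have "(i', j') = (i, j)"
          using uniq[of i j i' j'] Cons.prems x by auto
        then show False
          using ij' Cons.prems x by auto
      qed
      ultimately show ?case
        using Cons x by auto
    qed simp
    then show ?thesis by (simp add: ps_def)
  qed
  let ?xs = "concat (map (\<lambda>(i, j). [i, j]) ps)"
  \<comment> \<open>Positions outside all selected pairs, to be added by pool weakening.\<close>
  let ?ys = "filter (\<lambda>i. i \<notin> set ?xs) [0..<length p]"
  let ?gs = "map (\<lambda>(i, j). {i, j}) ps"
  have "CL5 (labelled ((!) p) ?xs ?gs)"
    using dist ps by (intro CL5_labelled_pairs) fastforce+
  then have "CL5 (labelled ((!) p) (?xs @ ?ys) ?gs)"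
    by (rule CL5_labelled_weaken) auto
  moreover have "mset (?xs @ ?ys) = mset [0..<length p]"
    using ps by (intro mset_append_complement dist) auto
  ultimately have "CL5 (labelled ((!) p) [0..<length p] ?gs)"
    using CL5_labelled_mset by blast
  moreover have "map (positions [0..<length p]) ?gs = ?gs"
    using ps by (intro map_idI positions_upt) auto
  ultimately have "CL5 (p, ?gs)"
    by (simp only: labelled_def map_nth)
  \<comment> \<open>Equality of the sets of groups suffices to return to one pair per group of
    \<open>s\<close>, in the order of \<open>s\<close> and with repetitions.\<close>
  then have "CL5 (p, map (\<lambda>g. case pr g of (i, j) \<Rightarrow> {i, j}) s)"
    by (rule CL5_set_groups[rotated]) (simp add: ps_def image_image)
  moreover have "(case pr g of (i, j) \<Rightarrow> {i, j}) \<subseteq> g" if "g \<in> set s" for g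
    using pr[OF that] by (auto simp: clash_def split: prod.splits)
  ultimately show ?thesis
    using CL5_weaken_groups[of s "\<lambda>g. case pr g of (i, j) \<Rightarrow> {i, j}" p "[]"] wf by simp
qed

section \<open>Inversion of the connective rules\<close>

text \<open>A right inverse of merging: the conjuncts go to separate copies of the group, and all
  its other oformulas to both.\<close>

definition split_and_group :: "nat \<Rightarrow> nat set \<Rightarrow> nat set list" where
  "split_and_group n g =
     (let h = collapse n -` g in if n \<in> g then [h - {Suc n}, h - {n}] else [h])"

lemma and_ready_split: "and_ready n (concat (map (split_and_group n) s))"
proof (induction s)
  case (Cons g s)
  then show ?case
    by (auto simp: split_and_group_def Let_def and_ready_Cons and_ready_Cons_Cons)
qed (simp add: and_ready_Nil)

lemma merge_groups_split:
  "map (image (collapse n)) (merge_groups n (concat (map (split_and_group n) s))) = s"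
proof (induction s)
  case (Cons g s)
  have "collapse n -` g - {Suc n} \<union> (collapse n -` g - {n}) = collapse n -` g"
    by auto
  with Cons show ?case
    by (simp add: split_and_group_def Let_def merge_groups_Cons)
qed simp

lemma is_cirquent_vimage_collapse:
  assumes "is_cirquent (p @ [H] @ q, s)" "g \<in> set s"
  shows "collapse (length p) -` g \<subseteq> {..<length (p @ [F, G] @ q)}"
proof -
  have "g \<subseteq> {..<length (p @ [H] @ q)}"
    using assms by (auto simp: is_cirquent_def)
  then show ?thesis
    by (force simp: collapse_def split: if_splits)
qed

text \<open>The induction measure is the total size of the pool alone, so the growth of the
  structure under splitting is harmless. Inversion removes one connective and preserves atom
  occurrences.\<close>

lemma binary_tautology_CL5: "binary_tautology (p, s) \<Longrightarrow> CL5 (p, s)"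
proof (induction "sum_list (map size p)" arbitrary: p s rule: less_induct)
  case less
  have wf: "is_cirquent (p, s)" and bin: "binary (p, s)" and taut: "tautology (p, s)"
    using less.prems by (auto simp: binary_tautology_def)
  have cases: "(\<forall>F\<in>set p. (\<exists>P. F = Atom P) \<or> (\<exists>P. F = NegAtom P)) \<or>
      (\<exists>F G. Or F G \<in> set p) \<or> (\<exists>F G. And F G \<in> set p)"
    by (metis formula.exhaust)
  consider "\<forall>F\<in>set p. (\<exists>P. F = Atom P) \<or> (\<exists>P. F = NegAtom P)"
    | a F G b where "p = a @ [Or F G] @ b" | a F G b where "p = a @ [And F G] @ b"
    using cases by (metis append_Cons append_Nil split_list)
  then show ?case
  proof cases
    case 1
    then show ?thesis using CL5_literals less.prems by blast
  next
    case (2 a F G b)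
    let ?n = "length a"
    \<comment> \<open>Every group with the disjunction receives both disjuncts, so nothing is lost
      in truth.\<close>
    let ?t = "map (vimage (collapse ?n)) s"
    have "is_cirquent (a @ [F, G] @ b, ?t)"
      using wf is_cirquent_vimage_collapse[of a "Or F G" b s _ F G] 2
      by (auto simp: is_cirquent_def)
    moreover have "binary (a @ [F, G] @ b, ?t)"
      using bin 2 by (simp add: binary_def cirquent_occs_def add_ac)
    moreover have "group_true M (a @ [F, G] @ b) (collapse ?n -` g)" if g: "g \<in> set s" for M g
    proof -
      have "group_true M (a @ [Or F G] @ b) (collapse ?n ` (collapse ?n -` g))"
        using taut 2 g by (simp add: tautology_def cirquent_true_def)
      then obtain i where i: "collapse ?n i \<in> g"
          "formula_true M ((a @ [Or F G] @ b) ! collapse ?n i)"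
        unfolding group_true_image by auto
      show ?thesis
      proof (cases "i = ?n \<or> i = Suc ?n")
        case True
        then have "?n \<in> g"
          using i(1) by (auto simp: collapse_def)
        then have "?n \<in> collapse ?n -` g" "Suc ?n \<in> collapse ?n -` g"
          by (auto simp: collapse_def)
        moreover have "formula_true M ((a @ [F, G] @ b) ! ?n) \<or>
            formula_true M ((a @ [F, G] @ b) ! Suc ?n)"
          using i(2) True by (auto simp: collapse_def nth_append)
        ultimately show ?thesis
          unfolding group_true_def by blast
      next
        case False
        then show ?thesis
          using i nth_collapse[of a "Or F G" b i F G] unfolding group_true_def by auto
      qed
    qed
    then have "tautology (a @ [F, G] @ b, ?t)"
      by (auto simp: tautology_def cirquent_true_def)
    ultimately have "CL5 (a @ [F, G] @ b, ?t)"
      using less.hyps[of "a @ [F, G] @ b" ?t] 2 by (simp add: binary_tautology_def)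
    from CL5.or_introduction[OF this] show ?thesis
      using 2 by (simp add: comp_def)
  next
    case (3 a F G b)
    let ?n = "length a"
    let ?t = "concat (map (split_and_group ?n) s)"
    have "is_cirquent (a @ [F, G] @ b, ?t)"
      using wf is_cirquent_vimage_collapse[of a "And F G" b s _ F G] 3
      by (fastforce simp: is_cirquent_def split_and_group_def Let_def split: if_splits)
    moreover have "binary (a @ [F, G] @ b, ?t)"
      using bin 3 by (simp add: binary_def cirquent_occs_def add_ac)
    moreover have "group_true M (a @ [F, G] @ b) h"
      if g: "g \<in> set s" and h: "h \<in> set (split_and_group ?n g)" for M g h
    proof -
      have "group_true M (a @ [And F G] @ b) (collapse ?n ` (collapse ?n -` g))"
        using taut 3 g by (simp add: tautology_def cirquent_true_def)
      then obtain i where i: "collapse ?n i \<in> g"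
          "formula_true M ((a @ [And F G] @ b) ! collapse ?n i)"
        unfolding group_true_image by auto
      show ?thesis
      proof (cases "i = ?n \<or> i = Suc ?n")
        case True
        then have "?n \<in> g"
          using i(1) by (auto simp: collapse_def)
        \<comment> \<open>Each half keeps one conjunct, and a true conjunction makes either one a
          witness.\<close>
        then have "?n \<in> h \<or> Suc ?n \<in> h"
          using h by (auto simp: split_and_group_def Let_def collapse_def)
        moreover have "formula_true M ((a @ [F, G] @ b) ! ?n)"
            "formula_true M ((a @ [F, G] @ b) ! Suc ?n)"
          using i(2) True by (auto simp: collapse_def nth_append)
        ultimately show ?thesis
          unfolding group_true_def by blast
      next
        case False
        \<comment> \<open>The halves differ from the preimage only at the conjuncts, so a witness
          elsewhere lies in both.\<close>
        then have "i \<in> h"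
          using i h by (auto simp: split_and_group_def Let_def split: if_splits)
        then show ?thesis
          using False i nth_collapse[of a "And F G" b i F G] unfolding group_true_def by auto
      qed
    qed
    then have "tautology (a @ [F, G] @ b, ?t)"
      by (auto simp: tautology_def cirquent_true_def)
    ultimately have "CL5 (a @ [F, G] @ b, ?t)"
      using less.hyps[of "a @ [F, G] @ b" ?t] 3 by (simp add: binary_tautology_def)
    from CL5.and_introduction[OF this and_ready_split] show ?thesis
      using 3 by (simp add: merge_groups_split)
  qed
qed

section \<open>Provability as being an instance of a binary tautology\<close>

theorem theorem7p5:
  fixes C :: "'a cirquent"
  assumes "infinite (UNIV :: 'a set)"
    and "is_cirquent C"
  shows "CL5 C \<longleftrightarrow> (\<exists>A :: 'a cirquent. binary_tautology A \<and> instance_of C A)"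
proof
  assume "CL5 C"
  then obtain p \<sigma> where p: "CL5 (p, snd C)" "binary (p, snd C)" "fst C = map (formula_subst \<sigma>) p"
    using CL5_instance_of_binary[OF assms(1) _ finite.emptyI] by blast
  then have "binary_tautology (p, snd C)"
    using CL5_is_cirquent CL5_sound by (auto simp: binary_tautology_def)
  moreover have "instance_of C (p, snd C)"
    using p(3) by (auto simp: instance_of_def cirquent_subst_def prod_eq_iff)
  ultimately show "\<exists>A :: 'a cirquent. binary_tautology A \<and> instance_of C A"
    by blast
next
  assume "\<exists>A :: 'a cirquent. binary_tautology A \<and> instance_of C A"
  then show "CL5 C"
    using binary_tautology_CL5 CL5_subst by (force simp: instance_of_def)
qed

end
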